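(* One has $$2\pi = \inf\{ \mathcal{K}(\gamma)\mid \gamma\in C^{2}(\mathbb{S}^1;\mathbb{R}^2) \text{ is a non-embedded immersion}\} = \inf \{ \mathcal{K}(\gamma)\mid \gamma\in C^{2}(\mathbb{S}^1;\mathbb{R}^2) \text{ is an immersion}\}.$$ Moreover, the first infimum (the one among non-embedded immersions) is not attained.
   Context: $\mathbb{S}^1=\mathbb{R}/\mathbb{Z}$. An immersion is a curve $\gamma$ with $|\gamma'|>0$ everywhere. The signed curvature is $\kappa=|\gamma'|^{-3}\det(\gamma',\gamma'')$, the arc-length element is $\mathrm{d}s=|\gamma'|\,\mathrm{d}x$, and the total curvature is $\mathcal{K}(\gamma)=\int_{\mathbb{S}^1}|\kappa|\,\mathrm{d}s$. An immersion is non-embedded if it is not an embedding. *)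

theory Defs
  imports "HOL-Analysis.Analysis"
begin

definition int_shift :: "real \<Rightarrow> real \<Rightarrow> bool" where
  "int_shift x y \<longleftrightarrow> x - y \<in> \<int>"

lemma equivp_int_shift: "equivp int_shift"
proof (rule equivpI)
  show "reflp int_shift"
    by (simp add: reflp_def int_shift_def)
  show "symp int_shift"
    unfolding symp_def int_shift_def by (metis Ints_minus minus_diff_eq)
  show "transp int_shift"
    unfolding transp_def int_shift_def
    by (metis Ints_add add_diff_eq diff_add_cancel)
qed

quotient_type circle = real / int_shift
  by (rule equivp_int_shift)

text \<open>\<open>circle\<close> is \<open>\<real>/\<int>\<close> with the quotient topology; \<open>abs_circle\<close> is the projection.\<close>

instantiation circle :: topological_space
begin

definition open_circle :: "circle set \<Rightarrow> bool" where
  "open_circle U \<longleftrightarrow> open (abs_circle -` U)"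

instance
proof
  show "open (UNIV :: circle set)"
    by (simp add: open_circle_def)
next
  fix S T :: "circle set"
  assume "open S" "open T"
  then show "open (S \<inter> T)"
    by (simp add: open_circle_def open_Int vimage_Int)
next
  fix K :: "circle set set"
  assume "\<forall>S\<in>K. open S"
  then show "open (\<Union>K)"
    by (auto simp: open_circle_def vimage_Union intro!: open_UN)
qed

end

type_synonym curve = "circle \<Rightarrow> real ^ 2"

definition lift :: "curve \<Rightarrow> real \<Rightarrow> real ^ 2" where
  "lift \<gamma> x = \<gamma> (abs_circle x)"

definition velocity :: "curve \<Rightarrow> real \<Rightarrow> real ^ 2" where
  "velocity \<gamma> x = vector_derivative (lift \<gamma>) (at x)"

definition acceleration :: "curve \<Rightarrow> real \<Rightarrow> real ^ 2" where
  "acceleration \<gamma> x = vector_derivative (velocity \<gamma>) (at x)"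

definition C2_curve :: "curve \<Rightarrow> bool" where
  "C2_curve \<gamma> \<longleftrightarrow>
     lift \<gamma> C1_differentiable_on UNIV \<and> velocity \<gamma> C1_differentiable_on UNIV"

text \<open>The differentiability conjunct is needed because \<open>vector_derivative\<close> has an
  unspecified value where the function is not differentiable.\<close>

definition immersion :: "curve \<Rightarrow> bool" where
  "immersion \<gamma> \<longleftrightarrow>
     lift \<gamma> C1_differentiable_on UNIV \<and> (\<forall>x. norm (velocity \<gamma> x) > 0)"

definition embedding :: "curve \<Rightarrow> bool" where
  "embedding \<gamma> \<longleftrightarrow> immersion \<gamma> \<and> embedding_map euclidean euclidean \<gamma>"

text \<open>The transpose makes the two vectors the columns of the matrix.\<close>

definition signed_curvature :: "curve \<Rightarrow> real \<Rightarrow> real" where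
  "signed_curvature \<gamma> x =
     det (transpose (vector [velocity \<gamma> x, acceleration \<gamma> x])) / norm (velocity \<gamma> x) ^ 3"

text \<open>Integration over \<open>\<real>/\<int>\<close> is integration over the fundamental domain \<open>[0,1]\<close>,
  with \<open>ds = \<bar>\<gamma>'\<bar> dx\<close>.\<close>

definition total_curvature :: "curve \<Rightarrow> real" where
  "total_curvature \<gamma> =
     integral {0..1} (\<lambda>x. \<bar>signed_curvature \<gamma> x\<bar> * norm (velocity \<gamma> x))"

definition C2_immersions :: "curve set" where
  "C2_immersions = {\<gamma>. C2_curve \<gamma> \<and> immersion \<gamma>}"

definition nonembedded_C2_immersions :: "curve set" where
  "nonembedded_C2_immersions = {\<gamma>. C2_curve \<gamma> \<and> immersion \<gamma> \<and> \<not> embedding \<gamma>}"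

end

theory Submission
  imports Defs
begin

text \<open>
  The plane is identified with the complex numbers. If \<open>z\<close> is the velocity of the curve, then
  \<open>\<kappa> ds = Im (z' / z) dx\<close>, where \<open>Im (z' / z)\<close> is the rate at which \<open>z\<close> turns. So the total curvature
  is the total variation, over one period, of an angle function \<open>\<theta>\<close> with \<open>z = \<bar>z\<bar> cis \<theta>\<close>
  (\<open>turning_angle_exists\<close>).

  Everything rests on one observation (\<open>closed_arc_turns_more_than_pi\<close>): on an arc that returns to
  its starting point the oscillation of \<open>\<theta>\<close> exceeds \<open>\<pi>\<close>. Otherwise the velocity would stay in a
  closed half-plane, and its component along the inner normal of that half-plane would be
  nonnegative, somewhere positive, and yet of integral zero.

  \<^item> A non-embedded immersion of the compact circle has a double point, which cuts it into two
    loops. Each of them has total curvature strictly above \<open>\<pi>\<close>, so the whole curve has total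
    curvature strictly above \<open>2\<pi>\<close>. This is the reason why the first infimum is not attained.

  \<^item> For an arbitrary closed curve, \<open>\<theta>\<close> grows by \<open>2\<pi>k\<close> over a period, with \<open>k\<close> an integer. If
    \<open>k \<noteq> 0\<close>, its variation is at least \<open>2\<pi>\<close>. If \<open>k = 0\<close>, then \<open>\<theta>\<close> has to make an excursion of
    more than \<open>\<pi>\<close> and come back, which again costs \<open>2\<pi>\<close>. This is Fenchel's inequality in the
    plane.

  \<^item> Thin figure eights approach the value \<open>2\<pi>\<close>: each lobe turns by \<open>\<pi>\<close> plus the small angle
    at which the two branches cross (\<open>total_curvature_eight_curve_le\<close>).
\<close>

section \<open>Turning of the tangent along an arc\<close>

text \<open>A path that avoids the origin is the exponential of an antiderivative \<open>L\<close> of its logarithmic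
  derivative, up to a constant factor, because \<open>z exp (-L)\<close> has derivative zero. The imaginary
  part of \<open>L\<close>, shifted by the argument of that factor, is then a differentiable angle.\<close>

lemma turning_angle_exists:
  fixes z w :: "real \<Rightarrow> complex"
  assumes deriv: "\<And>x. (z has_vector_derivative w x) (at x)"
    and cont: "continuous_on UNIV w"
    and nonzero: "\<And>x. z x \<noteq> 0"
  obtains \<theta> where "\<And>x. (\<theta> has_real_derivative Im (w x / z x)) (at x)"
    and "\<And>x. z x = of_real (norm (z x)) * cis (\<theta> x)"
proof -
  have "continuous (at x) z" for x
    using deriv has_vector_derivative_continuous by blast
  moreover have "continuous (at x) w" for x
    using cont by (simp add: continuous_on_eq_continuous_at)
  ultimately have "isCont (\<lambda>x. w x / z x) x" for x
    using nonzero by (intro continuous_intros) auto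
  then obtain L where L: "\<And>x. (L has_vector_derivative w x / z x) (at x)"
    using einterval_antiderivative[of "-\<infinity>" "\<infinity>" "\<lambda>x. w x / z x"] by auto
  have "((\<lambda>x. z x * exp (- L x)) has_vector_derivative 0) (at x)" for x
  proof -
    have "((\<lambda>x. - L x) has_vector_derivative - (w x / z x)) (at x)"
      by (rule has_vector_derivative_minus) (rule L)
    then have "((\<lambda>x. exp (- L x)) has_vector_derivative - (w x / z x) * exp (- L x)) (at x)"
      using field_vector_diff_chain_at[OF _ DERIV_exp] by (fastforce simp: o_def)
    from has_vector_derivative_mult[OF deriv this] show ?thesis
      using nonzero[of x] by (simp add: field_simps)
  qed
  then obtain k where k: "\<And>x. z x * exp (- L x) = k"
    using has_vector_derivative_zero_constant[of UNIV "\<lambda>x. z x * exp (- L x)"] by auto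
  have z: "z x = k * exp (L x)" for x
    using k[of x] by (simp add: exp_minus field_simps)
  define \<theta> where "\<theta> x = Arg k + Im (L x)" for x
  have "(\<theta> has_real_derivative Im (w x / z x)) (at x)" for x
    unfolding \<theta>_def using L[of x]
    by (auto simp: has_vector_derivative_complex_iff intro!: derivative_eq_intros)
  moreover have "z x = of_real (norm (z x)) * cis (\<theta> x)" for x
  proof -
    have "k = of_real (norm k) * cis (Arg k)"
      using rcis_cmod_Arg[of k] by (simp add: rcis_def)
    moreover have "exp (L x) = of_real (exp (Re (L x))) * cis (Im (L x))"
      by (simp add: exp_eq_polar)
    ultimately have "z x = of_real (norm k) * cis (Arg k) * (of_real (exp (Re (L x))) * cis (Im (L x)))"
      using z by simp
    then have "z x = of_real (norm k * exp (Re (L x))) * cis (\<theta> x)"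
      by (simp add: \<theta>_def flip: cis_mult)
    moreover have "norm (z x) = norm k * exp (Re (L x))"
      using z by (simp add: norm_mult)
    ultimately show ?thesis by simp
  qed
  ultimately show ?thesis using that by blast
qed

text \<open>Here \<open>z\<close> is the velocity of an arc with equal end points. If the angle stayed in an interval
  of length \<open>\<pi>\<close>, the component of \<open>z\<close> in the middle direction \<open>\<mu>\<close> of that interval would be
  nonnegative with integral zero, hence zero throughout; but by the intermediate value theorem
  \<open>z\<close> points exactly in direction \<open>\<mu>\<close> at some parameter. The use of the middle direction makes the
  inequality strict.\<close>

lemma closed_arc_turns_more_than_pi:
  fixes z :: "real \<Rightarrow> complex" and \<theta> :: "real \<Rightarrow> real"
  assumes "a < b"
    and contz: "continuous_on {a..b} z" and cont\<theta>: "continuous_on {a..b} \<theta>"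
    and nonzero: "\<And>x. x \<in> {a..b} \<Longrightarrow> z x \<noteq> 0"
    and polar: "\<And>x. x \<in> {a..b} \<Longrightarrow> z x = of_real (norm (z x)) * cis (\<theta> x)"
    and zero: "(z has_integral 0) {a..b}"
  obtains s t where "s \<in> {a..b}" "t \<in> {a..b}" "\<theta> t - \<theta> s > pi"
proof (rule ccontr)
  assume "\<not> thesis"
  then have osc: "\<theta> t - \<theta> s \<le> pi" if "s \<in> {a..b}" "t \<in> {a..b}" for s t
    using that \<open>\<And>t s. \<lbrakk>s \<in> {a..b}; t \<in> {a..b}; pi < \<theta> t - \<theta> s\<rbrakk> \<Longrightarrow> thesis\<close> by force
  have ne: "{a..b} \<noteq> {}" using \<open>a < b\<close> by auto
  obtain s where s: "s \<in> {a..b}" "\<And>x. x \<in> {a..b} \<Longrightarrow> \<theta> s \<le> \<theta> x"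
    using continuous_attains_inf[OF compact_Icc ne cont\<theta>] by auto
  obtain t where t: "t \<in> {a..b}" "\<And>x. x \<in> {a..b} \<Longrightarrow> \<theta> x \<le> \<theta> t"
    using continuous_attains_sup[OF compact_Icc ne cont\<theta>] by auto
  define \<mu> where "\<mu> = (\<theta> s + \<theta> t) / 2"
  have "connected (\<theta> ` {a..b})"
    using cont\<theta> by (intro connected_continuous_image) auto
  moreover have "\<theta> s \<le> \<mu>" "\<mu> \<le> \<theta> t"
    using s(2)[OF t(1)] by (auto simp: \<mu>_def)
  ultimately have "\<mu> \<in> \<theta> ` {a..b}"
    using connectedD_interval[OF _ imageI[OF s(1)] imageI[OF t(1)]] by blast
  then obtain m where m: "m \<in> {a..b}" "\<theta> m = \<mu>" by auto
  define h where "h x = Re (z x * cis (- \<mu>))" for x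
  have h: "h x = norm (z x) * cos (\<theta> x - \<mu>)" if "x \<in> {a..b}" for x
    by (subst h_def, subst polar[OF that]) (simp add: mult.assoc cis_mult)
  have "h x \<ge> 0" if "x \<in> {a..b}" for x
  proof -
    have "\<bar>\<theta> x - \<mu>\<bar> \<le> pi / 2"
      using s(2)[OF that] t(2)[OF that] osc[OF s(1) t(1)] 
      by (auto simp: \<mu>_def abs_le_iff field_simps)
    then show ?thesis unfolding h[OF that] abs_le_iff by (intro mult_nonneg_nonneg cos_ge_zero) auto
  qed
  moreover have "continuous_on {a..b} h"
    unfolding h_def using contz by (intro continuous_intros)
  moreover have "integral {a..b} h = 0"
  proof (rule integral_unique)
    have "bounded_linear (\<lambda>v. Re (v * cis (- \<mu>)))"
      using bounded_linear_compose[OF bounded_linear_Re bounded_linear_mult_left] .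
    from has_integral_linear[OF zero this] show "(h has_integral 0) {a..b}"
      by (simp add: o_def h_def[abs_def])
  qed
  ultimately have "h m = 0"
    using integral_eq_0_iff[of a b h] \<open>a < b\<close> m(1) by blast
  then show False using h[OF m(1)] m nonzero by simp
qed

lemma change_le_total_variation:
  fixes \<theta> :: "real \<Rightarrow> real"
  assumes deriv: "\<And>x. (\<theta> has_real_derivative \<omega> x) (at x)"
    and cont: "continuous_on UNIV \<omega>" and "s \<le> t"
  shows "\<bar>\<theta> t - \<theta> s\<bar> \<le> integral {s..t} (\<lambda>x. \<bar>\<omega> x\<bar>)"
proof -
  have I: "(\<omega> has_integral (\<theta> t - \<theta> s)) {s..t}"
    using deriv \<open>s \<le> t\<close>
    by (intro fundamental_theorem_of_calculus)
       (auto simp: has_real_derivative_iff_has_vector_derivative intro: has_vector_derivative_at_within)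
  have "norm (integral {s..t} \<omega>) \<le> integral {s..t} (\<lambda>x. \<bar>\<omega> x\<bar>)"
    by (rule integral_norm_bound_integral)
       (auto intro!: integrable_continuous_real continuous_intros continuous_on_subset[OF cont])
  then show ?thesis using integral_unique[OF I] by simp
qed

section \<open>Total turning of closed curves\<close>

locale closed_immersed_curve =
  fixes c z w :: "real \<Rightarrow> complex"
  assumes c_deriv: "\<And>x. (c has_vector_derivative z x) (at x)"
    and z_deriv: "\<And>x. (z has_vector_derivative w x) (at x)"
    and w_cont: "continuous_on UNIV w"
    and z_nonzero: "\<And>x. z x \<noteq> 0"
    and c_periodic: "\<And>x. c (x + 1) = c x"
begin

abbreviation turning_rate :: "real \<Rightarrow> real" where
  "turning_rate x \<equiv> Im (w x / z x)"

lemma periodic_derivative: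
  assumes "\<And>x. (f has_vector_derivative f' x) (at x)" "\<And>x. f (x + 1) = f x"
  shows "f' (x + 1) = (f' x :: complex)"
proof -
  have "((\<lambda>x. f (x + 1)) has_vector_derivative f' (x + 1)) (at x)"
    using vector_diff_chain_at[OF has_vector_derivative_add_const[THEN iffD2, OF has_vector_derivative_id],
        of f "f' (x + 1)" x 1] assms(1)[of "x + 1"]
    by (simp add: o_def)
  then show ?thesis
    unfolding assms(2) by (rule vector_derivative_unique_at) (rule assms(1))
qed

lemma z_periodic: "z (x + 1) = z x"
  by (rule periodic_derivative[OF c_deriv c_periodic])

lemma turning_rate_periodic: "turning_rate (x + 1) = turning_rate x"
  using periodic_derivative[OF z_deriv z_periodic] by (simp add: z_periodic)

lemma z_cont: "continuous_on A z"
  by (rule continuous_at_imp_continuous_on) (blast intro: has_vector_derivative_continuous z_deriv)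

lemma turning_rate_cont: "continuous_on A turning_rate"
  by (rule continuous_on_Im, rule continuous_on_divide)
    (simp_all add: z_cont z_nonzero continuous_on_subset[OF w_cont])

lemma turning_rate_integrable: "(\<lambda>x. \<bar>turning_rate x\<bar>) integrable_on {a..b}"
  by (intro integrable_continuous_real continuous_intros turning_rate_cont)

lemma turning_combine:
  assumes "p \<le> q" "q \<le> r"
  shows "integral {p..q} (\<lambda>x. \<bar>turning_rate x\<bar>) + integral {q..r} (\<lambda>x. \<bar>turning_rate x\<bar>)
    = integral {p..r} (\<lambda>x. \<bar>turning_rate x\<bar>)"
  by (rule Henstock_Kurzweil_Integration.integral_combine[OF assms turning_rate_integrable])

lemma loop_turning:
  assumes "a < b" "c a = c b"
    and \<theta>: "\<And>x. (\<theta> has_real_derivative turning_rate x) (at x)"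
    and polar: "\<And>x. z x = of_real (norm (z x)) * cis (\<theta> x)"
  obtains s t where "s \<in> {a..b}" "t \<in> {a..b}" "\<theta> t - \<theta> s > pi"
proof (rule closed_arc_turns_more_than_pi[OF \<open>a < b\<close> z_cont _ _ _ _ that])
  show "continuous_on {a..b} \<theta>"
    using DERIV_isCont[OF \<theta>] by (simp add: continuous_at_imp_continuous_on)
  show "(z has_integral 0) {a..b}"
    using fundamental_theorem_of_calculus[of a b c z] assms(1,2) c_deriv
    by (auto intro: has_vector_derivative_at_within)
qed (rule z_nonzero polar)+

lemma loop_total_turning:
  assumes "a < b" "c a = c b"
  shows "integral {a..b} (\<lambda>x. \<bar>turning_rate x\<bar>) > pi"
proof -
  obtain \<theta> where \<theta>: "\<And>x. (\<theta> has_real_derivative turning_rate x) (at x)"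
    and polar: "\<And>x. z x = of_real (norm (z x)) * cis (\<theta> x)"
    using turning_angle_exists[OF z_deriv w_cont z_nonzero] by blast
  obtain s t where st: "s \<in> {a..b}" "t \<in> {a..b}" "\<theta> t - \<theta> s > pi"
    using loop_turning[OF assms \<theta> polar] by blast
  have "\<bar>\<theta> (max s t) - \<theta> (min s t)\<bar> 
      \<le> integral {min s t..max s t} (\<lambda>x. \<bar>turning_rate x\<bar>)"
    by (rule change_le_total_variation[OF \<theta> turning_rate_cont]) simp
  also have "\<dots> \<le> integral {a..b} (\<lambda>x. \<bar>turning_rate x\<bar>)"
    using st by (intro integral_subset_le turning_rate_integrable) auto
  finally show ?thesis using st(3) by (auto simp: max_def min_def split: if_splits)
qed

text \<open>Fenchel's inequality in the plane; the integer \<open>k\<close> below is the rotation index.\<close>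

theorem total_turning_ge: "integral {0..1} (\<lambda>x. \<bar>turning_rate x\<bar>) \<ge> 2 * pi"
proof -
  let ?V = "\<lambda>a b. integral {a..b} (\<lambda>x. \<bar>turning_rate x\<bar>)"
  obtain \<theta> where \<theta>: "\<And>x. (\<theta> has_real_derivative turning_rate x) (at x)"
    and polar: "\<And>x. z x = of_real (norm (z x)) * cis (\<theta> x)"
    using turning_angle_exists[OF z_deriv w_cont z_nonzero] by blast
  have bound: "\<bar>\<theta> t - \<theta> s\<bar> \<le> ?V s t" if "s \<le> t" for s t
    by (rule change_le_total_variation[OF \<theta> turning_rate_cont that])
  have "z 1 = z 0" using z_periodic[of 0] by simp
  then have "of_real (norm (z 0)) * cis (\<theta> 1) = of_real (norm (z 0)) * cis (\<theta> 0)"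
    by (metis polar)
  then have "cis (\<theta> 1) = cis (\<theta> 0)"
    using z_nonzero[of 0] by simp
  then have "sin (\<theta> 1) = sin (\<theta> 0) \<and> cos (\<theta> 1) = cos (\<theta> 0)"
    by (auto simp: complex_eq_iff)
  then obtain k :: int where k: "\<theta> 1 = \<theta> 0 + 2 * pi * k"
    unfolding sin_cos_eq_iff by blast
  show ?thesis
  proof (cases "k = 0")
    case False
    then have "1 \<le> \<bar>real_of_int k\<bar>" by linarith
    then have "2 * pi * 1 \<le> 2 * pi * \<bar>real_of_int k\<bar>"
      by (intro mult_left_mono) auto
    also have "\<dots> = \<bar>\<theta> 1 - \<theta> 0\<bar>" using k by (simp add: abs_mult)
    also have "\<dots> \<le> ?V 0 1" by (rule bound) simp
    finally show ?thesis by simp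
  next
    case True
    \<comment> \<open>The angle starts and ends at the same value, so the stretches before \<open>p\<close> and after \<open>q\<close>
      together undo the change of more than \<open>\<pi>\<close> between \<open>p\<close> and \<open>q\<close>.\<close>
    have "c 0 = c 1" using c_periodic[of 0] by simp
    then obtain s t where st: "s \<in> {0..1}" "t \<in> {0..1}" "\<theta> t - \<theta> s > pi"
      using loop_turning[OF zero_less_one _ \<theta> polar] by blast
    define p q where "p = min s t" and "q = max s t"
    have pq: "0 \<le> p" "p \<le> q" "q \<le> 1" "\<bar>\<theta> q - \<theta> p\<bar> > pi"
      using st by (auto simp: p_def q_def max_def min_def)
    have "?V 0 p + ?V p q = ?V 0 q" "?V 0 q + ?V q 1 = ?V 0 1"
      using turning_combine[of 0 p q] turning_combine[of 0 q 1] pq by linarith+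
    then show ?thesis
      using bound[of 0 p] bound[of p q] bound[of q 1] pq k True by (simp; linarith)
  qed
qed

text \<open>The double point cuts the curve into two loops, over \<open>[a, b]\<close> and over \<open>[b, a + 1]\<close>; by
  periodicity the second one accounts for what the first one leaves of \<open>[0, 1]\<close>.\<close>

theorem total_turning_gt_of_double_point:
  assumes "0 \<le> a" "a < b" "b < 1" "c a = c b"
  shows "integral {0..1} (\<lambda>x. \<bar>turning_rate x\<bar>) > 2 * pi"
proof -
  let ?V = "\<lambda>a b. integral {a..b} (\<lambda>x. \<bar>turning_rate x\<bar>)"
  have "?V a b > pi" by (rule loop_total_turning) fact+
  moreover have "?V b (a + 1) > pi"
    by (rule loop_total_turning) (use assms c_periodic[of a] in auto)
  moreover have "?V 1 (a + 1) = ?V 0 a"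
    using has_integral_shift_Icc_real[of "\<lambda>x. \<bar>turning_rate x\<bar>" 1 "?V 1 (a+1)" 0 a]
      integrable_integral[OF turning_rate_integrable[of 1 "a + 1"]]
    by (auto simp: o_def add.commute[of 1] turning_rate_periodic intro!: integral_unique[symmetric])
  moreover have "?V 0 a + ?V a b = ?V 0 b" "?V 0 b + ?V b 1 = ?V 0 1" 
    "?V b 1 + ?V 1 (a + 1) = ?V b (a + 1)"
    using turning_combine[of 0 a b] turning_combine[of 0 b 1] turning_combine[of b 1 "a + 1"] assms
    by linarith+
  ultimately show ?thesis by simp
qed

end

section \<open>Total curvature of immersions of the circle\<close>

definition plane_to_complex :: "real ^ 2 \<Rightarrow> complex" where
  "plane_to_complex v = Complex (v $ 1) (v $ 2)"

definition complex_to_plane :: "complex \<Rightarrow> real ^ 2" where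
  "complex_to_plane u = vector [Re u, Im u]"

lemma complex_to_plane_to_complex [simp]: "plane_to_complex (complex_to_plane u) = u"
  by (simp add: plane_to_complex_def complex_to_plane_def)

lemma bounded_linear_plane_to_complex: "bounded_linear plane_to_complex"
  by (simp add: plane_to_complex_def complex_eq_iff linear_iff flip: linear_conv_bounded_linear)

lemma bounded_linear_complex_to_plane: "bounded_linear complex_to_plane"
  by (simp add: complex_to_plane_def vec_eq_iff forall_2 linear_iff flip: linear_conv_bounded_linear)

lemma norm_plane_to_complex: "norm (plane_to_complex v) = norm v"
  by (simp add: plane_to_complex_def cmod_def norm_vec_def L2_set_def sum_2)

lemma plane_to_complex_eq_0_iff [simp]: "plane_to_complex v = 0 \<longleftrightarrow> v = 0"
  using norm_plane_to_complex[of v] by (metis norm_eq_zero)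

lemma abs_circle_eq_iff: "abs_circle x = abs_circle y \<longleftrightarrow> x - y \<in> \<int>"
  using circle.abs_eq_iff int_shift_def by simp

lemma abs_circle_frac: "abs_circle (frac x) = abs_circle x"
  by (simp add: abs_circle_eq_iff frac_def)

text \<open>Both sides are \<open>\<bar>det (v, a)\<bar> / \<bar>v\<bar>\<^sup>2\<close>, with \<open>v\<close> the velocity and \<open>a\<close> the acceleration, since
  the determinant of two plane vectors is the imaginary part of \<open>a\<close> times the conjugate of \<open>v\<close>.\<close>

lemma curvature_element:
  "\<bar>signed_curvature \<gamma> x\<bar> * norm (velocity \<gamma> x)
    = \<bar>Im (plane_to_complex (acceleration \<gamma> x) / plane_to_complex (velocity \<gamma> x))\<bar>"
proof (cases "velocity \<gamma> x = 0")
  case False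
  define v a where "v = velocity \<gamma> x" and "a = acceleration \<gamma> x"
  have "Im (plane_to_complex a / plane_to_complex v) = (v$1 * a$2 - a$1 * v$2) / (norm v)\<^sup>2"
    by (simp add: Im_divide norm_plane_to_complex[symmetric] cmod_power2)
       (simp add: plane_to_complex_def algebra_simps)
  then show ?thesis using False
    by (simp add: signed_curvature_def det_2 transpose_def abs_divide power2_eq_square
        power3_eq_cube abs_mult flip: v_def a_def)
next
  case True
  then have "plane_to_complex (velocity \<gamma> x) = 0" by simp
  then show ?thesis using True by (metis abs_zero div_by_0 mult_zero_right norm_zero zero_complex.sel(2))
qed

lemma total_curvature_eq:
  "total_curvature \<gamma> = integral {0..1} (\<lambda>x. 
      \<bar>Im (plane_to_complex (acceleration \<gamma> x) / plane_to_complex (velocity \<gamma> x))\<bar>)"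
  by (simp add: total_curvature_def curvature_element)

lemma closed_immersed_curve_lift:
  assumes "C2_curve \<gamma>" "immersion \<gamma>"
  shows "closed_immersed_curve (\<lambda>x. plane_to_complex (lift \<gamma> x))
    (\<lambda>x. plane_to_complex (velocity \<gamma> x)) (\<lambda>x. plane_to_complex (acceleration \<gamma> x))"
proof
  note bl = bounded_linear_plane_to_complex
  fix x
  have "(lift \<gamma> has_vector_derivative velocity \<gamma> x) (at x)"
    using assms(1) unfolding C2_curve_def C1_differentiable_on_eq velocity_def
    by (metis UNIV_I vector_derivative_works)
  then show "((\<lambda>x. plane_to_complex (lift \<gamma> x)) has_vector_derivative
      plane_to_complex (velocity \<gamma> x)) (at x)"
    by (rule bounded_linear.has_vector_derivative[OF bl])
  have "(velocity \<gamma> has_vector_derivative acceleration \<gamma> x) (at x)"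
    using assms(1) unfolding C2_curve_def C1_differentiable_on_eq acceleration_def
    by (metis UNIV_I vector_derivative_works)
  then show "((\<lambda>x. plane_to_complex (velocity \<gamma> x)) has_vector_derivative
      plane_to_complex (acceleration \<gamma> x)) (at x)"
    by (rule bounded_linear.has_vector_derivative[OF bl])
  show "plane_to_complex (velocity \<gamma> x) \<noteq> 0"
    using assms(2) by (auto simp: immersion_def)
  show "plane_to_complex (lift \<gamma> (x + 1)) = plane_to_complex (lift \<gamma> x)"
    using abs_circle_eq_iff[of "x + 1" x] by (simp add: lift_def)
next
  have "continuous_on UNIV (acceleration \<gamma>)"
    using assms(1) by (simp add: C2_curve_def C1_differentiable_on_eq acceleration_def[abs_def])
  then show "continuous_on UNIV (\<lambda>x. plane_to_complex (acceleration \<gamma> x))"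
    by (rule bounded_linear.continuous_on[OF bounded_linear_plane_to_complex])
qed

lemma compact_circle: "compact (UNIV :: circle set)"
proof -
  have "continuous_on {0..1} abs_circle"
    by (rule continuous_on_subset[of UNIV])
       (auto simp: continuous_on_open_vimage open_circle_def)
  then have "compact (abs_circle ` {0..1})"
    by (rule compact_continuous_image) simp
  moreover have "abs_circle ` {0..1} = UNIV"
  proof -
    have "c \<in> abs_circle ` {0..1}" for c
    proof -
      have "c = abs_circle (frac (rep_circle c))"
        unfolding abs_circle_frac using Quotient_abs_rep[OF Quotient_circle] by simp
      then show ?thesis
        using frac_ge_0 frac_lt_1 by (metis atLeastAtMost_iff image_eqI less_imp_le)
    qed
    then show ?thesis by auto
  qed
  ultimately show ?thesis by simp
qed

text \<open>By compactness of the circle, self-intersection is the only way in which an immersion can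
  fail to be an embedding.\<close>

lemma injective_immersion_is_embedding:
  assumes "immersion \<gamma>" "inj \<gamma>"
  shows "embedding \<gamma>"
proof -
  have "continuous_on UNIV (lift \<gamma>)"
    using assms(1) unfolding immersion_def C1_differentiable_on_eq
    by (auto intro: continuous_at_imp_continuous_on differentiable_imp_continuous_within)
  moreover have "abs_circle -` (\<gamma> -` U) = lift \<gamma> -` U" for U
    by (auto simp: lift_def)
  ultimately have "continuous_on UNIV \<gamma>"
    by (auto simp: continuous_on_open_vimage open_circle_def)
  then have "embedding_map euclidean euclidean \<gamma>"
    using compact_circle \<open>inj \<gamma>\<close>
    by (intro continuous_imp_embedding_map) (auto simp: compact_space_def)
  then show ?thesis using assms(1) by (simp add: embedding_def)
qed

lemma total_curvature_ge:
  assumes "\<gamma> \<in> C2_immersions"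
  shows "total_curvature \<gamma> \<ge> 2 * pi"
  unfolding total_curvature_eq
  by (rule closed_immersed_curve.total_turning_ge[OF closed_immersed_curve_lift])
     (use assms in \<open>auto simp: C2_immersions_def\<close>)

lemma total_curvature_gt:
  assumes "\<gamma> \<in> nonembedded_C2_immersions"
  shows "total_curvature \<gamma> > 2 * pi"
proof -
  have g: "C2_curve \<gamma>" "immersion \<gamma>" "\<not> embedding \<gamma>"
    using assms by (auto simp: nonembedded_C2_immersions_def)
  then obtain p q where pq: "\<gamma> p = \<gamma> q" "p \<noteq> q"
    using injective_immersion_is_embedding injI by metis
  define a b where "a = frac (rep_circle p)" and "b = frac (rep_circle q)"
  have ab: "abs_circle a = p" "abs_circle b = q"
    unfolding a_def b_def abs_circle_frac using Quotient_abs_rep[OF Quotient_circle] by auto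
  have "a \<noteq> b" using ab pq by auto
  then have range: "0 \<le> min a b" "min a b < max a b" "max a b < 1"
    by (auto simp: a_def b_def frac_lt_1)
  have eq: "lift \<gamma> (min a b) = lift \<gamma> (max a b)"
    using ab pq by (auto simp: lift_def min_def max_def)
  show ?thesis
    unfolding total_curvature_eq
    by (rule closed_immersed_curve.total_turning_gt_of_double_point[
          OF closed_immersed_curve_lift[OF g(1,2)] range])
       (simp add: eq)
qed

section \<open>Thin figure eights\<close>

text \<open>With \<open>t = 2\<pi>x - \<pi>/2\<close> this is the Lissajous figure \<open>((1 + 2r\<^sup>2) cos t, (r/2) sin 2t)\<close>, flat for
  small \<open>r\<close>. The width \<open>1 + 2r\<^sup>2\<close> is chosen so that the squared speed factors, up to the constant
  \<open>4\<pi>\<^sup>2\<close>, as \<open>(r\<^sup>2 + u\<^sup>2) (1 + 4r\<^sup>2u\<^sup>2)\<close> with \<open>u = cos (2\<pi>x)\<close>; the tangent angle is then a sum of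
  two arctangents. The shift of the parameter puts the double point at \<open>x = 0\<close> and \<open>x = 1/2\<close>, which
  is also where the curvature changes sign.\<close>

definition eight :: "real \<Rightarrow> real \<Rightarrow> complex" where
  "eight r x = Complex ((1 + 2 * r\<^sup>2) * sin (2 * pi * x)) (- (r / 2) * sin (4 * pi * x))"

definition eight' :: "real \<Rightarrow> real \<Rightarrow> complex" where
  "eight' r x = Complex (2 * pi * (1 + 2 * r\<^sup>2) * cos (2 * pi * x)) (- 2 * pi * r * cos (4 * pi * x))"

definition eight'' :: "real \<Rightarrow> real \<Rightarrow> complex" where
  "eight'' r x = Complex (- 4 * pi\<^sup>2 * (1 + 2 * r\<^sup>2) * sin (2 * pi * x)) (8 * pi\<^sup>2 * r * sin (4 * pi * x))"

definition eight_curve :: "real \<Rightarrow> curve" where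
  "eight_curve r p = complex_to_plane (eight r (rep_circle p))"

lemma eight_deriv: "(eight r has_vector_derivative eight' r x) (at x)"
  unfolding has_vector_derivative_complex_iff eight_def eight'_def
  by (auto intro!: derivative_eq_intros)

lemma eight'_deriv: "(eight' r has_vector_derivative eight'' r x) (at x)"
  unfolding has_vector_derivative_complex_iff eight'_def eight''_def
  by (auto intro!: derivative_eq_intros simp: power2_eq_square)

lemma eight_add_int: "eight r (x + of_int n) = eight r x"
proof -
  have "sin (2 * pi * (x + of_int n)) = sin (2 * pi * x)"
    using sin_int_2pin[of n] cos_int_2pin[of n] by (simp add: ring_distribs sin_add)
  moreover have "sin (4 * pi * (x + of_int n)) = sin (4 * pi * x)"
    using sin_int_2pin[of "2 * n"] cos_int_2pin[of "2 * n"] by (simp add: ring_distribs sin_add mult.assoc)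
  ultimately show ?thesis by (simp add: eight_def)
qed

lemma lift_eight_curve: "lift (eight_curve r) = (\<lambda>x. complex_to_plane (eight r x))"
proof
  fix x
  have "abs_circle (rep_circle (abs_circle x)) = abs_circle x"
    using Quotient_abs_rep[OF Quotient_circle] .
  then obtain n where "rep_circle (abs_circle x) - x = of_int n"
    unfolding abs_circle_eq_iff by (auto elim: Ints_cases)
  then have "rep_circle (abs_circle x) = x + of_int n" by simp
  then show "lift (eight_curve r) x = complex_to_plane (eight r x)"
    by (simp add: lift_def eight_curve_def eight_add_int)
qed

lemma velocity_eight_curve: "velocity (eight_curve r) = (\<lambda>x. complex_to_plane (eight' r x))"
  unfolding velocity_def lift_eight_curve
  by (intro ext vector_derivative_at
      bounded_linear.has_vector_derivative[OF bounded_linear_complex_to_plane] eight_deriv)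

lemma acceleration_eight_curve: "acceleration (eight_curve r) = (\<lambda>x. complex_to_plane (eight'' r x))"
  unfolding acceleration_def velocity_eight_curve
  by (intro ext vector_derivative_at
      bounded_linear.has_vector_derivative[OF bounded_linear_complex_to_plane] eight'_deriv)

lemma cos_4pi: "cos (4 * pi * x) = 2 * (cos (2 * pi * x))\<^sup>2 - 1" for x :: real
  using cos_double_cos[of "2 * pi * x"] by (simp add: mult.assoc)

lemma eight'_nonzero:
  assumes "r > 0"
  shows "eight' r x \<noteq> 0"
proof
  assume "eight' r x = 0"
  moreover have "1 + 2 * r\<^sup>2 \<noteq> 0"
    by (smt (verit) zero_le_power2)
  ultimately have "cos (2 * pi * x) = 0" "cos (4 * pi * x) = 0"
    using assms by (auto simp: eight'_def complex_eq_iff)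
  then show False by (simp add: cos_4pi)
qed

lemma eight_curve_nonembedded:
  assumes "r > 0"
  shows "eight_curve r \<in> nonembedded_C2_immersions"
proof -
  note bl = bounded_linear_complex_to_plane
  have cont: "continuous_on UNIV (eight' r)" "continuous_on UNIV (eight'' r)"
    unfolding eight'_def[abs_def] eight''_def[abs_def] by (intro continuous_intros)+
  have C1: "lift (eight_curve r) C1_differentiable_on UNIV"
    unfolding C1_differentiable_on_def lift_eight_curve
    by (rule exI[of _ "\<lambda>x. complex_to_plane (eight' r x)"])
       (auto intro!: bounded_linear.has_vector_derivative[OF bl] eight_deriv
         bounded_linear.continuous_on[OF bl] cont)
  have C2: "velocity (eight_curve r) C1_differentiable_on UNIV"
    unfolding C1_differentiable_on_def velocity_eight_curve
    by (rule exI[of _ "\<lambda>x. complex_to_plane (eight'' r x)"])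
       (auto intro!: bounded_linear.has_vector_derivative[OF bl] eight'_deriv
         bounded_linear.continuous_on[OF bl] cont)
  have "velocity (eight_curve r) x \<noteq> 0" for x
  proof
    assume "velocity (eight_curve r) x = 0"
    then have "plane_to_complex (complex_to_plane (eight' r x)) = 0"
      unfolding velocity_eight_curve plane_to_complex_eq_0_iff .
    then show False using eight'_nonzero[OF assms] by simp
  qed
  moreover have "\<not> inj (eight_curve r)"
  proof
    assume inj: "inj (eight_curve r)"
    have "eight r 0 = eight r (1/2)"
      using sin_npi[of 2] by (simp add: eight_def)
    then have "eight_curve r (abs_circle 0) = eight_curve r (abs_circle (1/2))"
      using fun_cong[OF lift_eight_curve] by (simp add: lift_def)
    then have "abs_circle 0 = abs_circle (1/2)" using inj by (simp add: inj_eq)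
    then have "(1/2 :: real) \<in> \<int>" by (simp add: abs_circle_eq_iff)
    then show False by (auto elim!: Ints_cases simp: field_simps)
  qed
  ultimately show ?thesis
    using C1 C2 unfolding nonembedded_C2_immersions_def C2_curve_def immersion_def embedding_def
    by (auto simp: embedding_map_def dest: homeomorphic_imp_injective_map)
qed

text \<open>The partial fraction decomposition that belongs to the factorisation of the speed. Only the
  factor \<open>sin (2\<pi>x)\<close> can change its sign.\<close>

lemma eight_turning_rate:
  assumes "r > 0"
  shows "Im (eight'' r x / eight' r x) = 2 * pi * sin (2 * pi * x) *
    (r / (r\<^sup>2 + (cos (2 * pi * x))\<^sup>2) + 2 * r / (1 + 4 * r\<^sup>2 * (cos (2 * pi * x))\<^sup>2))"
proof -
  define u s where "u = cos (2 * pi * x)" and "s = sin (2 * pi * x)"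
  have c4: "cos (4 * pi * x) = 2 * u\<^sup>2 - 1"
    by (simp add: cos_4pi u_def)
  have s4: "sin (4 * pi * x) = 2 * s * u"
    using sin_double[of "2 * pi * x"] by (simp add: u_def s_def mult.assoc)
  have pos: "r\<^sup>2 + u\<^sup>2 > 0" "1 + 4 * r\<^sup>2 * u\<^sup>2 > 0"
    using assms by (auto intro!: add_pos_nonneg)
  have den: "(Re (eight' r x))\<^sup>2 + (Im (eight' r x))\<^sup>2
      = 4 * pi\<^sup>2 * ((r\<^sup>2 + u\<^sup>2) * (1 + 4 * r\<^sup>2 * u\<^sup>2))"
    by (simp add: eight'_def c4 flip: u_def s_def) algebra
  have num: "Im (eight'' r x) * Re (eight' r x) - Re (eight'' r x) * Im (eight' r x)
      = 4 * pi\<^sup>2 * (2 * pi * s * (r * (1 + 4 * r\<^sup>2 * u\<^sup>2) + 2 * r * (r\<^sup>2 + u\<^sup>2)))"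
    by (simp add: eight'_def eight''_def c4 s4 flip: u_def s_def) algebra
  have "Im (eight'' r x / eight' r x)
      = 2 * pi * s * (r * (1 + 4 * r\<^sup>2 * u\<^sup>2) + 2 * r * (r\<^sup>2 + u\<^sup>2)) / ((r\<^sup>2 + u\<^sup>2) * (1 + 4 * r\<^sup>2 * u\<^sup>2))"
    unfolding Im_divide num den by simp
  also have "\<dots> = 2 * pi * s * (r / (r\<^sup>2 + u\<^sup>2) + 2 * r / (1 + 4 * r\<^sup>2 * u\<^sup>2))"
    using pos by (subst add_frac_eq) auto
  finally show ?thesis by (simp add: u_def s_def)
qed

text \<open>The tangent angle is monotone on each lobe, so the turning of a lobe is the difference of
  the angles at its two ends.\<close>

lemma total_curvature_eight_curve:
  assumes "r > 0"
  shows "total_curvature (eight_curve r) = 4 * (arctan (1 / r) + arctan (2 * r))"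
proof -
  define \<omega> where "\<omega> x = Im (eight'' r x / eight' r x)" for x
  define G where "G x = - (arctan (cos (2 * pi * x) / r) + arctan (2 * r * cos (2 * pi * x)))" for x
  have "(G has_real_derivative \<omega> x) (at x)" for x
  proof -
    define u where "u = cos (2 * pi * x)"
    have pos: "r\<^sup>2 + u\<^sup>2 > 0" "1 + 4 * r\<^sup>2 * u\<^sup>2 > 0"
      using assms by (auto intro!: add_pos_nonneg)
    have eq: "inverse (1 + (u / r)\<^sup>2) = r * (r / (r\<^sup>2 + u\<^sup>2))" 
      using assms pos by (simp add: field_simps power2_eq_square)
    have eq2: "inverse (1 + (2 * r * u)\<^sup>2) = 1 / (1 + 4 * r\<^sup>2 * u\<^sup>2)" 
      by (simp add: power_mult_distrib inverse_eq_divide)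
    define s where "s = sin (2 * pi * x)"
    have "(G has_real_derivative 
        - (inverse (1 + (u / r)\<^sup>2) * (- s * (2 * pi) / r)
          + inverse (1 + (2 * r * u)\<^sup>2) * (2 * r * (- s * (2 * pi))))) (at x)"
      unfolding G_def u_def s_def using assms
      by (auto intro!: derivative_eq_intros)
    moreover have "- (inverse (1 + (u / r)\<^sup>2) * (- s * (2 * pi) / r)
          + inverse (1 + (2 * r * u)\<^sup>2) * (2 * r * (- s * (2 * pi)))) = \<omega> x"
      unfolding eq eq2 \<omega>_def eight_turning_rate[OF assms] u_def[symmetric] s_def[symmetric]
      using assms by (simp add: ring_distribs mult_ac)
    ultimately show ?thesis by simp
  qed
  then have FTC: "(\<omega> has_integral (G b - G a)) {a..b}" if "a \<le> b" for a b
    using that by (intro fundamental_theorem_of_calculus)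
      (auto simp: has_real_derivative_iff_has_vector_derivative intro: has_vector_derivative_at_within)
  have sign: "\<bar>\<omega> x\<bar> = \<sigma> * \<omega> x" if "\<sigma> * sin (2 * pi * x) \<ge> 0" "\<bar>\<sigma>\<bar> = 1" for \<sigma> x
  proof -
    have "0 \<le> 2 * pi * (\<sigma> * sin (2 * pi * x)) *
      (r / (r\<^sup>2 + (cos (2 * pi * x))\<^sup>2) + 2 * r / (1 + 4 * r\<^sup>2 * (cos (2 * pi * x))\<^sup>2))"
      using assms
      by (intro mult_nonneg_nonneg[OF mult_nonneg_nonneg[OF _ that(1)]] add_nonneg_nonneg
          divide_nonneg_nonneg) auto
    then have "0 \<le> \<sigma> * \<omega> x"
      unfolding \<omega>_def eight_turning_rate[OF assms] by (simp add: mult_ac)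
    then have "\<bar>\<sigma> * \<omega> x\<bar> = \<sigma> * \<omega> x" by simp
    then show ?thesis using that(2) by (simp add: abs_mult)
  qed
  have "((\<lambda>x. \<bar>\<omega> x\<bar>) has_integral (G (1/2) - G 0)) {0..1/2}"
  proof (rule has_integral_eq[OF _ FTC])
    fix x :: real assume "x \<in> {0..1/2}"
    then have "sin (2 * pi * x) \<ge> 0" by (intro sin_ge_zero) auto
    then show "\<omega> x = \<bar>\<omega> x\<bar>" using sign[of 1 x] by simp
  qed simp
  moreover have "((\<lambda>x. \<bar>\<omega> x\<bar>) has_integral - (G 1 - G (1/2))) {1/2..1}"
  proof (rule has_integral_eq[OF _ has_integral_neg[OF FTC]])
    fix x :: real assume "x \<in> {1/2..1}"
    then have "sin (2 * pi * x - pi) \<ge> 0" by (intro sin_ge_zero) auto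
    then have "sin (2 * pi * x) \<le> 0" by simp
    then show "- \<omega> x = \<bar>\<omega> x\<bar>" using sign[of "-1" x] by simp
  qed simp
  ultimately have "((\<lambda>x. \<bar>\<omega> x\<bar>) has_integral (G (1/2) - G 0) + - (G 1 - G (1/2))) {0..1}"
    by (rule has_integral_combine[rotated 2]) auto
  moreover have "G 0 = - (arctan (1 / r) + arctan (2 * r))" "G 1 = G 0" 
    "G (1/2) = arctan (1 / r) + arctan (2 * r)"
    by (auto simp: G_def arctan_minus)
  ultimately show ?thesis
    unfolding total_curvature_eq velocity_eight_curve acceleration_eight_curve
    by (simp add: \<omega>_def integral_unique)
qed

lemma total_curvature_eight_curve_le:
  assumes "r > 0"
  shows "total_curvature (eight_curve r) \<le> 2 * pi + 8 * r"
proof -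
  have "arctan (2 * r) \<le> 2 * r" using assms by (intro arctan_le_self) auto
  then show ?thesis
    using total_curvature_eight_curve[OF assms] arctan_ubound[of "1 / r"] by (simp; linarith)
qed

theorem theorem1p1:
  shows "ereal (2 * pi) = (INF \<gamma> \<in> nonembedded_C2_immersions. ereal (total_curvature \<gamma>))
    \<and> (INF \<gamma> \<in> nonembedded_C2_immersions. ereal (total_curvature \<gamma>))
           = (INF \<gamma> \<in> C2_immersions. ereal (total_curvature \<gamma>))
    \<and> \<not> (\<exists>\<gamma> \<in> nonembedded_C2_immersions.
             ereal (total_curvature \<gamma>)
               = (INF \<gamma> \<in> nonembedded_C2_immersions. ereal (total_curvature \<gamma>)))"
proof -
  let ?N = "INF \<gamma> \<in> nonembedded_C2_immersions. ereal (total_curvature \<gamma>)"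
  let ?I = "INF \<gamma> \<in> C2_immersions. ereal (total_curvature \<gamma>)"
  have lower: "ereal (2 * pi) \<le> ?I"
    by (intro INF_greatest) (simp add: total_curvature_ge)
  have "nonembedded_C2_immersions \<subseteq> C2_immersions"
    by (auto simp: nonembedded_C2_immersions_def C2_immersions_def)
  then have mono: "?I \<le> ?N" by (rule INF_superset_mono) simp
  have upper: "?N \<le> ereal (2 * pi)"
  proof (rule ereal_le_epsilon2)
    fix e :: real assume "e > 0"
    then have r: "e / 8 > 0" by simp
    have "?N \<le> ereal (total_curvature (eight_curve (e / 8)))"
      by (rule INF_lower[OF eight_curve_nonembedded[OF r]])
    also have "\<dots> \<le> ereal (2 * pi) + ereal e"
      using total_curvature_eight_curve_le[OF r] by simp
    finally show "?N \<le> ereal (2 * pi) + ereal e" .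
  qed
  have N: "?N = ereal (2 * pi)" and I: "?I = ereal (2 * pi)"
    using lower mono upper by (meson antisym order_trans)+
  show ?thesis
    unfolding N I using total_curvature_gt by fastforce
qed

end
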